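(* Let $G$ be a linear congestion game. Then the robust price of anarchy of all friendship extensions $G^\alpha$ of $G$ is at most $\frac{17}{3}$. This bound is tight, i.e., the supremum of the robust price of anarchy over all friendship extensions of linear congestion games equals $\frac{17}{3}$.
   Context: An atomic congestion game $G=(N,E,\{\Sigma_i\}_{i\in N},(d_e)_{e\in E})$ has a finite player set $N$, a finite set $E$ of resources with delay functions $d_e:\mathbb N\to\mathbb R_+$, and strategy sets $\Sigma_i\subseteq\mathcal P(E)$. For $s\in\Sigma=\prod_i\Sigma_i$ let $x_e(s)=|\{i\in N: e\in s_i\}|$; the cost of player $i$ is $C_i(s)=\sum_{e\in s_i}d_e(x_e(s))$ and the social cost is $C(s)=\sum_{i\in N}C_i(s)$. $G$ is linear if all delay functions are linear, i.e. $d_e(x)=a_ex+b_e$ with $a_e,b_e\ge0$. $(t_i,s_{-i})$ denotes $s$ with player $i$'s strategy replaced by $t_i$. Friendship extension: for $\alpha\in[0,1]^{N\times N}$ with $\alpha_{ii}=1$ for all $i$, $G^\alpha$ is the game with the same players and strategies and costs $C_i^\alpha=\sum_{j\in N}\alpha_{ij}C_j$; its social cost is again $C$. Smoothness: $G^\alpha$ is $(\lambda,\mu)$-smooth if there is a (possibly randomized) profile $\bar s$ such that for all $s\in\Sigma$ and all optima $s^*$ (minimizers of $C$), $$\sum_i\Big(C_i(\bar s_i,s_{-i})+\sum_{j\ne i}\alpha_{ij}\big(C_j(\bar s_i,s_{-i})-C_j(s)\big)\Big)\le\lambda C(s^* )+\mu C(s)$$ (left-hand side in expectation over $\bar s$ if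 it is randomized). The robust price of anarchy of $G^\alpha$ is $\inf\{\frac{\lambda}{1-\mu} : G^\alpha\text{ is }(\lambda,\mu)\text{-smooth},\ \mu<1\}$. *)

theory Defs
  imports "HOL-Probability.Probability"
begin

record ('p, 'e) congestion_game =
  players :: "'p set"
  resources :: "'e set"
  strategies :: "'p \<Rightarrow> 'e set set"
  delay :: "'e \<Rightarrow> nat \<Rightarrow> real"

text \<open>Strategy sets are nonempty, so that strategy profiles exist.\<close>

definition atomic_congestion_game :: "('p, 'e) congestion_game \<Rightarrow> bool" where
  "atomic_congestion_game G \<longleftrightarrow>
     finite (players G) \<and> finite (resources G) \<and>
     (\<forall>i\<in>players G. strategies G i \<noteq> {} \<and> strategies G i \<subseteq> Pow (resources G)) \<and>
     (\<forall>e\<in>resources G. \<forall>x. 0 \<le> delay G e x)"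

definition linear_congestion_game :: "('p, 'e) congestion_game \<Rightarrow> bool" where
  "linear_congestion_game G \<longleftrightarrow>
     atomic_congestion_game G \<and>
     (\<forall>e\<in>resources G. \<exists>a b. 0 \<le> a \<and> 0 \<le> b \<and> (\<forall>x. delay G e x = a * real x + b))"

text \<open>Profiles are extensional functions on the player set, hence there are finitely many;
  the profile \<open>(t\<^sub>i, s\<^sub>-\<^sub>i)\<close> is written \<open>s(i := t)\<close>.\<close>

definition profiles :: "('p, 'e) congestion_game \<Rightarrow> ('p \<Rightarrow> 'e set) set" where
  "profiles G = (\<Pi>\<^sub>E i\<in>players G. strategies G i)"

definition load :: "('p, 'e) congestion_game \<Rightarrow> ('p \<Rightarrow> 'e set) \<Rightarrow> 'e \<Rightarrow> nat" where
  "load G s e = card {i \<in> players G. e \<in> s i}"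

definition cost :: "('p, 'e) congestion_game \<Rightarrow> 'p \<Rightarrow> ('p \<Rightarrow> 'e set) \<Rightarrow> real" where
  "cost G i s = (\<Sum>e\<in>s i. delay G e (load G s e))"

definition social_cost :: "('p, 'e) congestion_game \<Rightarrow> ('p \<Rightarrow> 'e set) \<Rightarrow> real" where
  "social_cost G s = (\<Sum>i\<in>players G. cost G i s)"

definition optimum :: "('p, 'e) congestion_game \<Rightarrow> ('p \<Rightarrow> 'e set) \<Rightarrow> bool" where
  "optimum G s \<longleftrightarrow> is_arg_min (social_cost G) (\<lambda>t. t \<in> profiles G) s"

text \<open>A friendship extension of \<open>G\<close> is given by \<open>G\<close> together with a weight matrix \<open>\<alpha>\<close>
  on the players of \<open>G\<close>; players, strategies and social cost are those of \<open>G\<close>.\<close>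

definition friendship_weights ::
    "('p, 'e) congestion_game \<Rightarrow> ('p \<Rightarrow> 'p \<Rightarrow> real) \<Rightarrow> bool" where
  "friendship_weights G \<alpha> \<longleftrightarrow>
     (\<forall>i\<in>players G. \<forall>j\<in>players G. 0 \<le> \<alpha> i j \<and> \<alpha> i j \<le> 1) \<and>
     (\<forall>i\<in>players G. \<alpha> i i = 1)"

definition friendship_cost ::
    "('p, 'e) congestion_game \<Rightarrow> ('p \<Rightarrow> 'p \<Rightarrow> real) \<Rightarrow> 'p \<Rightarrow> ('p \<Rightarrow> 'e set) \<Rightarrow> real" where
  "friendship_cost G \<alpha> i s = (\<Sum>j\<in>players G. \<alpha> i j * cost G j s)"

definition smoothness_sum ::
    "('p, 'e) congestion_game \<Rightarrow> ('p \<Rightarrow> 'p \<Rightarrow> real) \<Rightarrow> ('p \<Rightarrow> 'e set) \<Rightarrow> ('p \<Rightarrow> 'e set) \<Rightarrow> real" where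
  "smoothness_sum G \<alpha> t s =
     (\<Sum>i\<in>players G. cost G i (s(i := t i)) +
        (\<Sum>j\<in>players G - {i}. \<alpha> i j * (cost G j (s(i := t i)) - cost G j s)))"

lemma smoothness_sum_friendship_cost:
  assumes "finite (players G)" "friendship_weights G \<alpha>"
  shows "smoothness_sum G \<alpha> t s =
     (\<Sum>i\<in>players G. friendship_cost G \<alpha> i (s(i := t i)) -
        (\<Sum>j\<in>players G - {i}. \<alpha> i j * cost G j s))"
  unfolding smoothness_sum_def
proof (rule sum.cong[OF refl])
  fix i assume i: "i \<in> players G"
  have "friendship_cost G \<alpha> i (s(i := t i)) = cost G i (s(i := t i)) +
      (\<Sum>j\<in>players G - {i}. \<alpha> i j * cost G j (s(i := t i)))"
    using assms i unfolding friendship_cost_def friendship_weights_def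
    by (simp add: sum.remove)
  then show "cost G i (s(i := t i)) +
        (\<Sum>j\<in>players G - {i}. \<alpha> i j * (cost G j (s(i := t i)) - cost G j s)) =
      friendship_cost G \<alpha> i (s(i := t i)) - (\<Sum>j\<in>players G - {i}. \<alpha> i j * cost G j s)"
    by (simp add: right_diff_distrib sum_subtractf)
qed

text \<open>The randomized profile is a distribution \<open>\<sigma>\<close> on profiles, a deterministic one being
  \<open>return_pmf\<close>. Each summand of \<open>smoothness_sum G \<alpha> t s\<close> depends on a single component of
  \<open>t\<close>, so the expectation sees only the marginals of \<open>\<sigma>\<close>: whether or not the components
  are required to be independent makes no difference.\<close>

definition smooth ::
    "('p, 'e) congestion_game \<Rightarrow> ('p \<Rightarrow> 'p \<Rightarrow> real) \<Rightarrow> real \<Rightarrow> real \<Rightarrow> bool" where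
  "smooth G \<alpha> l m \<longleftrightarrow>
     (\<exists>\<sigma>. set_pmf \<sigma> \<subseteq> profiles G \<and>
        (\<forall>s\<in>profiles G. \<forall>s'. optimum G s' \<longrightarrow>
           measure_pmf.expectation \<sigma> (\<lambda>t. smoothness_sum G \<alpha> t s)
             \<le> l * social_cost G s' + m * social_cost G s))"

text \<open>The infimum is taken in the extended reals, so it is \<open>\<infinity>\<close> if no pair is admissible, and
  it may be \<open>-\<infinity>\<close> if the optimal social cost is zero.\<close>

definition robust_poa :: "('p, 'e) congestion_game \<Rightarrow> ('p \<Rightarrow> 'p \<Rightarrow> real) \<Rightarrow> ereal" where
  "robust_poa G \<alpha> = Inf {ereal (l / (1 - m)) | l m. smooth G \<alpha> l m \<and> m < 1}"

end

theory Submission imports Defs begin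

text \<open>Upper bound: take an optimum as the deviation profile. If a resource with delay \<open>a x + b\<close>
  has load \<open>x\<close> in \<open>s\<close> and \<open>y\<close> in the optimum, then each of the \<open>y\<close> deviating players pays at
  most \<open>a (x + 1) + b\<close> on it and raises the cost of the at most \<open>x\<close> other players by \<open>a\<close> each,
  so smoothness with \<open>(\<lambda>, \<mu>) = (17/5, 2/5)\<close> reduces to \<open>y (2 x + 1) \<le> 17/5 y\<^sup>2 + 2/5 x\<^sup>2\<close>.
  For \<open>y = 1\<close> this is tight exactly at \<open>x = 2\<close> and \<open>x = 3\<close>.

  Tightness: a game with an equilibrium all of whose resources have such loads, where in
  addition a deviating player never relieves a friend. Six players are split into two groups
  by parity; friends are the players of the other group, and in the equilibrium everybody
  uses only the resources that the other group uses in the optimum.\<close>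

section \<open>Sums over resources and bounds on loads\<close>

text \<open>Double counting: after swapping the sums, \<open>e\<close> contributes once per player
  using it.\<close>

lemma sum_players_sum_strategy:
  fixes f :: "'e \<Rightarrow> real"
  assumes "atomic_congestion_game G" "s \<in> profiles G"
  shows "(\<Sum>i\<in>players G. \<Sum>e\<in>s i. f e) = (\<Sum>e\<in>resources G. real (load G s e) * f e)"
proof -
  have fin: "finite (players G)" "finite (resources G)"
    using assms(1) by (auto simp: atomic_congestion_game_def)
  have sub: "s i \<subseteq> resources G" if "i \<in> players G" for i
    using assms that by (fastforce simp: atomic_congestion_game_def profiles_def)
  have "(\<Sum>i\<in>players G. \<Sum>e\<in>s i. f e) =
      (\<Sum>i\<in>players G. \<Sum>e\<in>resources G. if e \<in> s i then f e else 0)"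
    by (rule sum.cong[OF refl], subst sum.inter_restrict[symmetric])
      (use fin sub in \<open>auto simp: Int_absorb1\<close>)
  also have "\<dots> = (\<Sum>e\<in>resources G. \<Sum>i\<in>players G. if e \<in> s i then f e else 0)"
    by (rule sum.swap)
  also have "\<dots> = (\<Sum>e\<in>resources G. real (load G s e) * f e)"
    by (rule sum.cong[OF refl], subst sum.inter_filter[symmetric])
      (use fin in \<open>auto simp: load_def\<close>)
  finally show ?thesis .
qed

lemma social_cost_eq_sum_resources:
  assumes "atomic_congestion_game G" "s \<in> profiles G"
  shows "social_cost G s = (\<Sum>e\<in>resources G. real (load G s e) * delay G e (load G s e))"
  unfolding social_cost_def cost_def by (rule sum_players_sum_strategy[OF assms])

lemma load_deviation_le:
  assumes "finite (players G)"
  shows "load G (s(i := u)) e \<le> load G s e + of_bool (e \<in> u)"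
proof (cases "e \<in> u")
  case True
  have "card {k \<in> players G. e \<in> (s(i := u)) k} \<le> card (insert i {k \<in> players G. e \<in> s k})"
    by (rule card_mono) (use assms in auto)
  also have "\<dots> \<le> Suc (card {k \<in> players G. e \<in> s k})"
    by (rule card_insert_le_m1) auto
  finally show ?thesis using True by (simp add: load_def)
next
  case False
  then have "card {k \<in> players G. e \<in> (s(i := u)) k} \<le> card {k \<in> players G. e \<in> s k}"
    by (intro card_mono) (use assms in \<open>auto split: if_splits\<close>)
  then show ?thesis using False by (simp add: load_def)
qed

lemma load_inequality:
  fixes x y :: nat
  shows "real y * (2 * real x + 1) \<le> 17 / 5 * (real y * real y) + 2 / 5 * (real x * real x)"
proof -
  consider "y = 0" | "y = 1" | "y \<ge> 2" by linarith
  then show ?thesis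
  proof cases
    case 2
    \<comment> \<open>The gap for \<open>y = 1\<close> is 2/5 of this product, nonnegative because
      no natural number lies strictly between 2 and 3.\<close>
    have "0 \<le> (real x - 2) * (real x - 3)"
      by (cases "x \<le> 2") (auto intro: mult_nonpos_nonpos)
    then show ?thesis using 2 by (simp add: algebra_simps)
  next
    case 3
    \<comment> \<open>Ten times the gap is this square plus \<open>9 y * y - 10 y\<close>.\<close>
    have "0 \<le> (2 * real x - 5 * real y)\<^sup>2" by simp
    moreover have "2 * real y \<le> real y * real y" using 3 by (intro mult_right_mono) auto
    ultimately show ?thesis by (simp add: power2_eq_square algebra_simps)
  qed simp
qed

section \<open>Smoothness and the upper bound\<close>

lemma smoothness_sum_le:
  assumes G: "atomic_congestion_game G" and al: "friendship_weights G \<alpha>"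
    and a: "\<And>e. e \<in> resources G \<Longrightarrow> 0 \<le> a e" and b: "\<And>e. e \<in> resources G \<Longrightarrow> 0 \<le> b e"
    and d: "\<And>e x. e \<in> resources G \<Longrightarrow> delay G e x = a e * real x + b e"
    and s: "s \<in> profiles G" and t: "t \<in> profiles G"
  shows "smoothness_sum G \<alpha> t s \<le> 17 / 5 * social_cost G t + 2 / 5 * social_cost G s"
proof -
  let ?P = "players G" and ?R = "resources G"
  let ?x = "\<lambda>e. real (load G s e)" and ?y = "\<lambda>e. real (load G t e)"
  have fin: "finite ?P" "finite ?R" using G by (auto simp: atomic_congestion_game_def)
  have sub: "s i \<subseteq> ?R" "t i \<subseteq> ?R" if "i \<in> ?P" for i
    using G s t that by (fastforce simp: atomic_congestion_game_def profiles_def)+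
  have load: "real (load G (s(i := t i)) e) \<le> ?x e + of_bool (e \<in> t i)" for i e
    using load_deviation_le[OF fin(1), of s i "t i" e]
    by (cases "e \<in> t i") (simp_all del: of_nat_Suc add: of_nat_mono flip: of_nat_Suc)
  have "smoothness_sum G \<alpha> t s \<le> (\<Sum>i\<in>?P. \<Sum>e\<in>t i. a e * (2 * ?x e + 1) + b e)"
    unfolding smoothness_sum_def
  proof (rule sum_mono)
    fix i assume i: "i \<in> ?P"
    have own: "cost G i (s(i := t i)) \<le> (\<Sum>e\<in>t i. a e * (?x e + 1) + b e)"
    proof -
      have "a e * real (load G (s(i := t i)) e) \<le> a e * (?x e + 1)" if "e \<in> t i" for e
        using load[of i e] that sub(2)[OF i] by (intro mult_left_mono a) auto
      then show ?thesis
        unfolding cost_def fun_upd_same using sub(2)[OF i] by (intro sum_mono) (auto simp: d)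
    qed
    have other: "\<alpha> i j * (cost G j (s(i := t i)) - cost G j s)
        \<le> (\<Sum>e\<in>s j. of_bool (e \<in> t i) * a e)" if j: "j \<in> ?P - {i}" for j
    proof -
      have "cost G j (s(i := t i)) - cost G j s =
          (\<Sum>e\<in>s j. a e * (real (load G (s(i := t i)) e) - ?x e))"
        unfolding cost_def sum_subtractf[symmetric] using j sub(1)[of j]
        by (auto simp: sum_subtractf[symmetric] d algebra_simps intro!: sum.cong)
      also have "\<dots> \<le> (\<Sum>e\<in>s j. a e * of_bool (e \<in> t i))"
      proof (intro sum_mono mult_left_mono)
        fix e assume "e \<in> s j"
        then show "0 \<le> a e" using j sub(1)[of j] a by auto
      qed (use load in \<open>simp add: diff_le_eq add.commute\<close>)
      finally have le: "cost G j (s(i := t i)) - cost G j s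
          \<le> (\<Sum>e\<in>s j. of_bool (e \<in> t i) * a e)" by (simp add: mult.commute)
      \<comment> \<open>The cost difference may be negative, so the weight is dropped only from its
        nonnegative upper bound.\<close>
      have "0 \<le> (\<Sum>e\<in>s j. of_bool (e \<in> t i) * a e)"
        using j sub(1)[of j] a by (intro sum_nonneg) auto
      moreover have "0 \<le> \<alpha> i j" "\<alpha> i j \<le> 1" using al i j by (auto simp: friendship_weights_def)
      ultimately show ?thesis
        using mult_left_mono[OF le, of "\<alpha> i j"] mult_right_mono[of "\<alpha> i j" 1] by fastforce
    qed
    have "(\<Sum>j\<in>?P - {i}. \<alpha> i j * (cost G j (s(i := t i)) - cost G j s))
        \<le> (\<Sum>j\<in>?P - {i}. \<Sum>e\<in>s j. of_bool (e \<in> t i) * a e)"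
      by (rule sum_mono[OF other])
    \<comment> \<open>Adding back the term of \<open>i\<close> itself completes the count of the
      other users to the full load.\<close>
    also have "\<dots> \<le> (\<Sum>j\<in>?P. \<Sum>e\<in>s j. of_bool (e \<in> t i) * a e)"
      using sub(1) a fin by (intro sum_mono2 sum_nonneg) auto
    also have "\<dots> = (\<Sum>e\<in>?R. if e \<in> t i then ?x e * a e else 0)"
      unfolding sum_players_sum_strategy[OF G s] by (intro sum.cong) auto
    also have "\<dots> = (\<Sum>e\<in>t i. ?x e * a e)"
      by (subst sum.inter_restrict[symmetric]) (use fin sub(2)[OF i] in \<open>auto simp: Int_absorb1\<close>)
    finally show "cost G i (s(i := t i)) +
        (\<Sum>j\<in>?P - {i}. \<alpha> i j * (cost G j (s(i := t i)) - cost G j s))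
        \<le> (\<Sum>e\<in>t i. a e * (2 * ?x e + 1) + b e)"
      using own by (simp add: sum.distrib distrib_left mult.left_commute[of _ 2] mult.commute
          flip: sum_distrib_left)
  qed
  also have "\<dots> = (\<Sum>e\<in>?R. ?y e * (a e * (2 * ?x e + 1) + b e))"
    by (rule sum_players_sum_strategy[OF G t])
  also have "\<dots> \<le> (\<Sum>e\<in>?R. 17 / 5 * (?y e * delay G e (load G t e)) +
      2 / 5 * (?x e * delay G e (load G s e)))"
  proof (rule sum_mono)
    fix e assume e: "e \<in> ?R"
    have "a e * (?y e * (2 * ?x e + 1)) \<le> a e * (17 / 5 * (?y e * ?y e) + 2 / 5 * (?x e * ?x e))"
      by (intro mult_left_mono load_inequality a e)
    \<comment> \<open>The constant part of the delay only needs
      \<open>b y \<le> 17/5 b y + 2/5 b x\<close>.\<close>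
    moreover have "0 \<le> b e * ?y e" "0 \<le> b e * ?x e" using b[OF e] by auto
    ultimately show "?y e * (a e * (2 * ?x e + 1) + b e) \<le>
        17 / 5 * (?y e * delay G e (load G t e)) + 2 / 5 * (?x e * delay G e (load G s e))"
      by (simp add: d[OF e] algebra_simps)
  qed
  also have "\<dots> = 17 / 5 * social_cost G t + 2 / 5 * social_cost G s"
    by (simp add: social_cost_eq_sum_resources G s t sum.distrib sum_distrib_left)
  finally show ?thesis .
qed

lemma optimum_exists:
  assumes "atomic_congestion_game G"
  shows "\<exists>s. optimum G s"
proof -
  have "finite (strategies G i)" if "i \<in> players G" for i
    using assms that by (meson atomic_congestion_game_def finite_Pow_iff finite_subset)
  then have "finite (profiles G)"
    using assms by (auto simp: profiles_def atomic_congestion_game_def intro!: finite_PiE)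
  moreover have "profiles G \<noteq> {}"
    using assms by (auto simp: profiles_def atomic_congestion_game_def PiE_eq_empty_iff)
  ultimately show ?thesis
    using ex_is_arg_min_if_finite[of "profiles G" "social_cost G"]
    by (simp add: optimum_def)
qed

lemma smooth_linear_congestion_game:
  assumes "linear_congestion_game G" "friendship_weights G \<alpha>"
  shows "smooth G \<alpha> (17 / 5) (2 / 5)"
proof -
  have G: "atomic_congestion_game G" using assms(1) by (simp add: linear_congestion_game_def)
  obtain a b where ab: "\<forall>e\<in>resources G. 0 \<le> a e \<and> 0 \<le> b e \<and>
      (\<forall>x. delay G e x = a e * real x + b e)"
    using assms(1) unfolding linear_congestion_game_def by metis
  obtain t where t: "optimum G t" using optimum_exists[OF G] by blast
  then have tp: "t \<in> profiles G" by (simp add: optimum_def is_arg_min_def)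
  show ?thesis
    unfolding smooth_def
  proof (intro exI[of _ "return_pmf t"] conjI ballI allI impI)
    fix s s' assume s: "s \<in> profiles G" and s': "optimum G s'"
    \<comment> \<open>Smoothness ranges over all optima, but \<open>t\<close> is one fixed optimum;
      they share the same cost.\<close>
    have "social_cost G s' = social_cost G t"
      using s' t by (auto simp: optimum_def is_arg_min_linorder intro: order.antisym)
    then show "measure_pmf.expectation (return_pmf t) (\<lambda>t. smoothness_sum G \<alpha> t s)
        \<le> 17 / 5 * social_cost G s' + 2 / 5 * social_cost G s"
      using smoothness_sum_le[OF G assms(2) _ _ _ s tp, of a b] ab by simp
  qed (use tp in auto)
qed

lemma robust_poa_le:
  assumes "linear_congestion_game G" "friendship_weights G \<alpha>"
  shows "robust_poa G \<alpha> \<le> ereal (17 / 3)"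
  unfolding robust_poa_def
proof (rule Inf_lower, intro CollectI exI conjI)
  show "smooth G \<alpha> (17 / 5) (2 / 5)" by (rule smooth_linear_congestion_game[OF assms])
qed auto

section \<open>The lower bound and a game attaining it\<close>

text \<open>A constant smoothness sum makes the expectation independent of the distribution on
  profiles. Only \<open>t\<close> being a profile matters: replacing its cost by the optimal one can only
  increase the ratio.\<close>

lemma robust_poa_ge:
  assumes G: "atomic_congestion_game G" and s: "s \<in> profiles G" and t: "t \<in> profiles G"
    and eq: "\<And>u. u \<in> profiles G \<Longrightarrow> smoothness_sum G \<alpha> u s = social_cost G s"
    and pos: "0 < social_cost G s" "0 < social_cost G t"
  shows "ereal (social_cost G s / social_cost G t) \<le> robust_poa G \<alpha>"
  unfolding robust_poa_def
proof (rule Inf_greatest, safe)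
  fix l m :: real assume sm: "smooth G \<alpha> l m" and m: "m < 1"
  obtain s' where s': "optimum G s'" using optimum_exists[OF G] by blast
  then have le: "social_cost G s' \<le> social_cost G t" and s'p: "s' \<in> profiles G"
    using t by (auto simp: optimum_def is_arg_min_linorder)
  have nonneg: "0 \<le> social_cost G s'"
    unfolding social_cost_eq_sum_resources[OF G s'p]
    using G by (intro sum_nonneg) (auto simp: atomic_congestion_game_def)
  obtain \<sigma> where \<sigma>: "set_pmf \<sigma> \<subseteq> profiles G" and
    ex: "measure_pmf.expectation \<sigma> (\<lambda>t. smoothness_sum G \<alpha> t s)
      \<le> l * social_cost G s' + m * social_cost G s"
    using sm s s' unfolding smooth_def by blast
  have "measure_pmf.expectation \<sigma> (\<lambda>t. smoothness_sum G \<alpha> t s) =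
      measure_pmf.expectation \<sigma> (\<lambda>t. social_cost G s)"
    by (rule integral_cong_AE) (use \<sigma> eq in \<open>auto simp: AE_measure_pmf_iff\<close>)
  then have *: "(1 - m) * social_cost G s \<le> l * social_cost G s'"
    using ex by (simp add: algebra_simps)
  moreover have "0 < (1 - m) * social_cost G s" using m pos by simp
  \<comment> \<open>The sign of \<open>l\<close> is what allows \<open>s'\<close> to be replaced by
    the possibly costlier \<open>t\<close>.\<close>
  ultimately have "0 < l" using nonneg by (smt (verit) mult_nonpos_nonneg)
  then have "l * social_cost G s' \<le> l * social_cost G t" using le by simp
  then show "ereal (social_cost G s / social_cost G t) \<le> ereal (l / (1 - m))"
    using * m pos by (simp add: divide_simps mult.commute)
qed

text \<open>Player \<open>i\<close> owns the resources \<open>i\<close>, of delay \<open>x\<close>, and \<open>6 + i\<close>, of delay \<open>2 x\<close>. In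
  the equilibrium the former have load 3 and the latter load 2.\<close>

definition tight_opt :: "nat \<Rightarrow> nat set" where
  "tight_opt i = {i, 6 + i}"

text \<open>Three shifts for the first kind of resource and two for the second produce the loads 3
  and 2; all shifts are odd, so every owner reached is a friend.\<close>

definition tight_eq :: "nat \<Rightarrow> nat set" where
  "tight_eq i = {(i + 1) mod 6, (i + 3) mod 6, (i + 5) mod 6, 6 + (i + 1) mod 6, 6 + (i + 3) mod 6}"

text \<open>With delays \<open>p x\<close> and \<open>q x\<close> on the two kinds, staying in the
  equilibrium costs a player \<open>9 p + 4 q\<close>, while deviating, with the harm to friends,
  amounts to \<open>7 p + 5 q\<close>. Equality means \<open>q = 2 p\<close>.\<close>

definition tight_game :: "(nat, nat) congestion_game" where
  "tight_game = \<lparr>players = {..<6}, resources = {..<12},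
     strategies = (\<lambda>i. {tight_eq i, tight_opt i}),
     delay = (\<lambda>e x. (if e < 6 then 1 else 2) * real x)\<rparr>"

definition tight_weights :: "nat \<Rightarrow> nat \<Rightarrow> real" where
  "tight_weights i j = (if i = j \<or> odd (i + j) then 1 else 0)"

lemma linear_tight_game: "linear_congestion_game tight_game"
proof -
  have "tight_eq i \<union> tight_opt i \<subseteq> {..<12}" if "i < 6" for i
  proof -
    have "i = 0 \<or> i = 1 \<or> i = 2 \<or> i = 3 \<or> i = 4 \<or> i = 5" using that by linarith
    then show ?thesis by (elim disjE) (simp_all add: tight_eq_def tight_opt_def)
  qed
  moreover have "\<exists>a b. 0 \<le> a \<and> 0 \<le> b \<and> (\<forall>x. delay tight_game e x = a * real x + b)" for e
    by (intro exI[of _ "if e < 6 then 1 else 2"] exI[of _ 0]) (auto simp: tight_game_def)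
  ultimately show ?thesis
    unfolding linear_congestion_game_def atomic_congestion_game_def
    by (auto simp: tight_game_def)
qed

lemma friendship_tight_weights: "friendship_weights tight_game tight_weights"
  by (simp add: friendship_weights_def tight_weights_def)

lemma players_tight_game: "players tight_game = {0, 1, 2, 3, 4, 5}"
  by (auto simp: tight_game_def)

text \<open>An explicit sum of six indicators lets the simplifier evaluate concrete loads.\<close>

lemma load_tight_game:
  "load tight_game s e = (\<Sum>i\<in>{0, 1, 2, 3, 4, 5}. of_bool (e \<in> s i))"
proof -
  have "load G s e = (\<Sum>i\<in>players G. of_bool (e \<in> s i))" if "finite (players G)"
    for G :: "(nat, nat) congestion_game"
    using that by (simp add: load_def Int_def)
  from this[of tight_game] show ?thesis by (simp only: players_tight_game finite.intros)
qed

lemma tight_profiles: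
  "restrict tight_eq {..<6} \<in> profiles tight_game"
  "restrict tight_opt {..<6} \<in> profiles tight_game"
  by (auto simp: profiles_def tight_game_def)

text \<open>Each of the six players pays 3 * 3 + 2 * 4 = 17 under \<open>tight_eq\<close> and 1 + 2
  = 3 under \<open>tight_opt\<close>.\<close>

lemma tight_social_cost:
  "social_cost tight_game (restrict tight_eq {..<6}) = 102"
  "social_cost tight_game (restrict tight_opt {..<6}) = 18"
  by (simp_all add: social_cost_def cost_def players_tight_game load_tight_game
      tight_eq_def tight_opt_def) (simp_all add: tight_game_def)

text \<open>Moving to \<open>tight_opt i\<close> costs 4 + 6 and harms the friends by 3 + 4. The
  other users of the abandoned resources have the parity of \<open>i\<close>, so their relief has
  weight 0.\<close>

lemma tight_deviation:
  assumes "i < 6" "T \<in> {tight_eq i, tight_opt i}"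
  defines "s \<equiv> restrict tight_eq {..<6}"
  shows "cost tight_game i (s(i := T)) + (\<Sum>j\<in>players tight_game - {i}.
      tight_weights i j * (cost tight_game j (s(i := T)) - cost tight_game j s)) = 17"
proof -
  have i: "i = 0 \<or> i = 1 \<or> i = 2 \<or> i = 3 \<or> i = 4 \<or> i = 5" using assms(1) by linarith
  from assms(2) consider "T = tight_eq i" | "T = tight_opt i" by blast
  then show ?thesis
    using i unfolding s_def
    by (cases; elim disjE)
      (simp_all add: cost_def players_tight_game load_tight_game insert_Diff_if
        tight_eq_def tight_opt_def tight_weights_def, simp_all add: tight_game_def)
qed

lemma robust_poa_tight_game: "ereal (17 / 3) \<le> robust_poa tight_game tight_weights"
proof -
  let ?s = "restrict tight_eq {..<6}" and ?t = "restrict tight_opt {..<6}"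
  have eq: "smoothness_sum tight_game tight_weights u ?s = social_cost tight_game ?s"
    if "u \<in> profiles tight_game" for u
  proof -
    have "u i \<in> {tight_eq i, tight_opt i}" if "i < 6" for i
      using \<open>u \<in> profiles tight_game\<close> that by (auto simp: profiles_def tight_game_def)
    then have "smoothness_sum tight_game tight_weights u ?s = (\<Sum>i\<in>players tight_game. 17)"
      unfolding smoothness_sum_def
      by (intro sum.cong refl tight_deviation) (simp_all add: tight_game_def)
    then show ?thesis by (simp add: tight_social_cost players_tight_game)
  qed
  have "ereal (social_cost tight_game ?s / social_cost tight_game ?t)
      \<le> robust_poa tight_game tight_weights"
    by (rule robust_poa_ge)
      (use linear_tight_game tight_profiles eq in
        \<open>auto simp: linear_congestion_game_def tight_social_cost\<close>)
  then show ?thesis by (simp add: tight_social_cost)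
qed

theorem theorem8:
  "(\<forall>(G :: ('p, 'e) congestion_game) \<alpha>.
      linear_congestion_game G \<longrightarrow> friendship_weights G \<alpha> \<longrightarrow> robust_poa G \<alpha> \<le> ereal (17 / 3)) \<and>
   (SUP (G, \<alpha>) \<in> {(G :: (nat, nat) congestion_game, \<alpha>).
      linear_congestion_game G \<and> friendship_weights G \<alpha>}. robust_poa G \<alpha>) = ereal (17 / 3)"
proof (intro conjI allI impI antisym)
  show "robust_poa G \<alpha> \<le> ereal (17 / 3)"
    if "linear_congestion_game G" "friendship_weights G \<alpha>"
    for G :: "('p, 'e) congestion_game" and \<alpha>
    using that by (rule robust_poa_le)
  show "(SUP (G, \<alpha>) \<in> {(G :: (nat, nat) congestion_game, \<alpha>).
      linear_congestion_game G \<and> friendship_weights G \<alpha>}. robust_poa G \<alpha>) \<le> ereal (17 / 3)"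
    by (rule SUP_least) (auto intro: robust_poa_le)
  show "ereal (17 / 3) \<le> (SUP (G, \<alpha>) \<in> {(G :: (nat, nat) congestion_game, \<alpha>).
      linear_congestion_game G \<and> friendship_weights G \<alpha>}. robust_poa G \<alpha>)"
    by (rule SUP_upper2[of "(tight_game, tight_weights)"])
      (simp_all add: linear_tight_game friendship_tight_weights robust_poa_tight_game)
qed

end
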